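(* Let $p$ be a prime and let $A \subset \mathbb{F}_p$ with $|A| > 1$. Then $$L(A) \geq 2\left(1 - \frac{|A|}{p}\right),$$ or equivalently $$\sup_{d \in \mathbb{F}_p^{\times}} g(d \cdot A) \geq 2\left(\frac{p}{|A|} - 1\right).$$
   Context: Let $p$ be a prime, $\mathbb{F}_p$ the field with $p$ elements, and $\mathbb{F}_p^{\times}$ its set of nonzero elements. For a nonempty set $A \subset \mathbb{F}_p$, $g(A)$ denotes the largest gap in $A$, i.e. the largest integer $g(A)$ such that there is a $t \in \mathbb{F}_p$ satisfying $(\{1, \ldots, g(A)\} + t) \cap A = \emptyset$, where the integers $1, \ldots, g(A)$ are viewed as elements of $\mathbb{F}_p$ by reduction modulo $p$ (and $\{1,\ldots,0\}$ is the empty set, so $g(A) = 0$ when $A = \mathbb{F}_p$). For $d \in \mathbb{F}_p^{\times}$, the dilate of $A$ by $d$ is $d \cdot A := \{da : a \in A\}$. Define $$L(A) := \frac{|A|}{p} \sup_{d \in \mathbb{F}_p^{\times}} g(d \cdot A).$$ *)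

theory Defs
  imports Complex_Main "Berlekamp_Zassenhaus.Finite_Field"
begin

text \<open>
  The field with p elements is \<^typ>\<open>'p mod_ring\<close>, where the index type is of class
  \<^class>\<open>prime_card\<close>, i.e. p is the prime cardinality of \<^typ>\<open>'p\<close>.
  Integers are reduced modulo p by \<^const>\<open>of_nat\<close>.
\<close>

definition gap_at_least :: "'p::prime_card mod_ring set \<Rightarrow> nat \<Rightarrow> bool" where
  "gap_at_least A k \<longleftrightarrow> (\<exists>t. (\<lambda>i. of_nat i + t) ` {1..k} \<inter> A = {})"

definition largest_gap :: "'p::prime_card mod_ring set \<Rightarrow> nat" where
  "largest_gap A = (GREATEST k. gap_at_least A k)"

definition dilate :: "'p::prime_card mod_ring \<Rightarrow> 'p mod_ring set \<Rightarrow> 'p mod_ring set" where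
  "dilate d A = (\<lambda>a. d * a) ` A"

definition L :: "'p::prime_card mod_ring set \<Rightarrow> real" where
  "L A = real (card A) / real CARD('p) * (SUP d \<in> UNIV - {0}. real (largest_gap (dilate d A)))"

text \<open>
  For nonempty sets the maximum defining \<^const>\<open>largest_gap\<close> exists.
  (For the empty set its value is unspecified.)
\<close>

lemma gap_at_least_0: "gap_at_least A 0"
  by (simp add: gap_at_least_def)

lemma gap_at_least_less:
  fixes A :: "'p::prime_card mod_ring set"
  assumes "A \<noteq> {}" and "gap_at_least A k"
  shows "k < CARD('p)"
proof (rule ccontr)
  assume "\<not> k < CARD('p)"
  hence k: "CARD('p) \<le> k" by simp
  obtain t where t: "(\<lambda>i. of_nat i + t) ` {1..k} \<inter> A = {}"
    using assms(2) by (auto simp: gap_at_least_def)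
  obtain a where a: "a \<in> A" using assms(1) by auto
  obtain m where m: "m < CARD('p)" "a - t = of_nat m"
    using surj_of_nat_mod_ring by blast
  define i where "i = (if m = 0 then CARD('p) else m)"
  have "of_nat i = a - t" "i \<in> {1..k}"
    using m k by (auto simp: i_def)
  hence "a = of_nat i + t" by simp
  with \<open>i \<in> {1..k}\<close> have "a \<in> (\<lambda>i. of_nat i + t) ` {1..k}" by (rule rev_image_eqI)
  with t a show False by auto
qed

lemma gap_at_least_largest_gap:
  fixes A :: "'p::prime_card mod_ring set"
  assumes "A \<noteq> {}"
  shows "gap_at_least A (largest_gap A)"
  unfolding largest_gap_def
  using gap_at_least_less[OF assms]
  by (intro GreatestI_nat[where P = "gap_at_least A" and b = "CARD('p)", OF gap_at_least_0])
     (blast intro: less_imp_le)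

lemma largest_gap_ge:
  fixes A :: "'p::prime_card mod_ring set"
  assumes "A \<noteq> {}" and "gap_at_least A k"
  shows "k \<le> largest_gap A"
  unfolding largest_gap_def
  using gap_at_least_less[OF assms(1)]
  by (intro Greatest_le_nat[where P = "gap_at_least A" and b = "CARD('p)", OF assms(2)])
     (blast intro: less_imp_le)

end

(*
  Let M bound all the gaps and put k = M + 1, so that a dilate of A meets every interval of length k.
  If k < p, then for w \<noteq> 0 the polynomial P_w(T) = \<Prod>_{a \<in> A} \<Prod>_{1 \<le> i \<le> k} (T + a - i w) of degree
  N = k |A| vanishes on F_p, so T^p - T divides it. In the sum Q of P_w over all w, power sums kill
  every coefficient of degree above N - (p - 1). With F = \<Prod>_{a \<in> A} (T + a) this makes
  F^k = P_0 = (T^p - T) g + Q = T^p g + h lacunary (Redei's method): deg g = N - p and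
  deg h \<le> N - p + 1. Since the derivative of T^p vanishes, F^(k-1) divides the Wronskian
  h g' - h' g, which is nonzero because k < p. As its degree is at most 2 (N - p), comparing
  degrees gives |A| (k + 1) \<ge> 2 p. If k \<ge> p, this inequality is immediate from |A| \<ge> 2.
*)

theory Submission
  imports Defs
begin

section \<open>Power sums and the degree of the averaged product\<close>

lemma sum_power_mod_ring_eq_0:
  assumes "j < CARD('p::prime_card) - 1"
  shows "(\<Sum>w\<in>UNIV. (w :: 'p mod_ring) ^ j) = 0"
proof (cases "j = 0")
  case True
  \<comment> \<open>Since \<open>0 ^ 0 = 1\<close>, the sum counts the whole field, and p is 0 in
    it.\<close>
  then show ?thesis by simp
next
  case False
  \<comment> \<open>Otherwise T^j - 1, of degree j < p - 1, would vanish at all p - 1 units. Scaling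
    by such a \<open>d\<close> permutes the terms of the power sum but multiplies it by d^j, so the
    sum is 0.\<close>
  have "\<exists>d :: 'p mod_ring. d \<noteq> 0 \<and> d ^ j \<noteq> 1"
  proof (rule ccontr)
    assume "\<not> ?thesis"
    hence sub: "UNIV - {0} \<subseteq> {d :: 'p mod_ring. poly (monom 1 j - 1) d = 0}"
      by (auto simp: poly_monom)
    have "coeff (monom 1 j - 1 :: 'p mod_ring poly) j = 1"
      using False by simp
    hence nz: "(monom 1 j - 1 :: 'p mod_ring poly) \<noteq> 0" by force
    have "CARD('p) - 1 = card (UNIV - {0 :: 'p mod_ring})" by (simp add: card_Diff_singleton)
    also have "\<dots> \<le> card {d :: 'p mod_ring. poly (monom 1 j - 1) d = 0}"
      by (intro card_mono sub) simp
    also have "\<dots> \<le> degree (monom 1 j - 1 :: 'p mod_ring poly)"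
      by (rule poly_roots_degree[OF nz])
    also have "\<dots> \<le> j" by (intro degree_diff_le degree_monom_le) simp
    finally show False using assms by simp
  qed
  then obtain d :: "'p mod_ring" where d: "d \<noteq> 0" "d ^ j \<noteq> 1" by blast
  have "(\<Sum>w\<in>UNIV. (w :: 'p mod_ring) ^ j) = (\<Sum>w\<in>UNIV. (d * w) ^ j)"
    by (rule sum.reindex_bij_witness[where i = "\<lambda>w. d * w" and j = "\<lambda>w. w / d"])
       (use d in auto)
  also have "\<dots> = d ^ j * (\<Sum>w\<in>UNIV. w ^ j)"
    by (simp add: power_mult_distrib sum_distrib_left)
  finally have "(1 - d ^ j) * (\<Sum>w\<in>UNIV. (w :: 'p mod_ring) ^ j) = 0"
    by (simp add: algebra_simps)
  with d show ?thesis by simp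
qed

text \<open>The outer variable is W and the coefficients are polynomials in T: the factors are T + c
  s - (b s) W, each of degree at most 1 in W.\<close>

lemma degree_prod_bivariate_linear:
  fixes c b :: "'s \<Rightarrow> 'a::idom"
  assumes "finite S"
  shows "degree (\<Prod>s\<in>S. [:[:c s, 1:], [:- b s:]:]) \<le> card S"
proof -
  have "degree (\<Prod>s\<in>S. [:[:c s, 1:], [:- b s:]:]) \<le> (\<Sum>s\<in>S. degree [:[:c s, 1:], [:- b s:]:])"
    using degree_prod_sum_le[OF assms] by (simp only: o_def)
  also have "\<dots> \<le> (\<Sum>s\<in>S. 1)"
    by (intro sum_mono order.trans[OF degree_pCons_le]) simp
  finally show ?thesis by simp
qed

text \<open>The product has total degree at most |S| in T and W, so a factor W^j leaves at most |S|
  - j for T.\<close>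

lemma degree_coeff_prod_bivariate_linear:
  fixes c b :: "'s \<Rightarrow> 'a::idom"
  assumes "finite S"
  shows "degree (coeff (\<Prod>s\<in>S. [:[:c s, 1:], [:- b s:]:]) j) \<le> card S - j"
  using assms
proof (induction S arbitrary: j rule: finite_induct)
  case empty
  then show ?case by (cases j) auto
next
  case (insert x S)
  define P where "P = (\<Prod>s\<in>S. [:[:c s, 1:], [:- b s:]:])"
  have "degree (coeff ([:[:c x, 1:], [:- b x:]:] * P) j) \<le> Suc (card S) - j"
  proof (cases j)
    case 0
    have "degree ([:c x, 1:] * coeff P 0) \<le> 1 + (card S - 0)"
      using insert.IH[of 0] degree_mult_le[of "[:c x, 1:]" "coeff P 0"]
      by (simp add: P_def del: mult_pCons_left)
    with 0 show ?thesis by (simp del: mult_pCons_left add: mult_pCons_left[of _ _ P])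
  next
    case (Suc i)
    have eq: "coeff ([:[:c x, 1:], [:- b x:]:] * P) j
        = [:c x, 1:] * coeff P (Suc i) + smult (- b x) (coeff P i)"
      using Suc by (simp del: mult_pCons_left add: mult_pCons_left[of _ _ P]) simp
    have 1: "degree ([:c x, 1:] * coeff P (Suc i)) \<le> card S - i"
    proof (cases "i < card S")
      case True
      have "degree ([:c x, 1:] * coeff P (Suc i)) \<le> 1 + (card S - Suc i)"
        using insert.IH[of "Suc i"] degree_mult_le[of "[:c x, 1:]" "coeff P (Suc i)"]
        by (simp add: P_def del: mult_pCons_left)
      with True show ?thesis by simp
    next
      case False
      \<comment> \<open>The subtraction is truncated here: the induction hypothesis would only give
        degree 0, and the linear factor would raise it to 1.\<close>
      hence "coeff P (Suc i) = 0"
        using degree_prod_bivariate_linear[OF insert.hyps(1), of c b]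
        by (intro coeff_eq_0) (simp add: P_def)
      then show ?thesis by simp
    qed
    have 2: "degree (smult (- b x) (coeff P i)) \<le> card S - i"
      using insert.IH[of i] degree_smult_le[of "- b x" "coeff P i"] by (simp add: P_def)
    show ?thesis unfolding eq using degree_add_le[OF 1 2] Suc by simp
  qed
  then show ?case using insert.hyps by (simp add: P_def)
qed

text \<open>Summing over w replaces W^j by a power sum, so only coefficients with j \<ge> p - 1
  survive, and these have low degree in T.\<close>

lemma degree_sum_prod_linear_mod_ring:
  fixes c b :: "'s \<Rightarrow> 'p::prime_card mod_ring"
  assumes "finite S"
  shows "degree (\<Sum>w\<in>UNIV. \<Prod>s\<in>S. [:c s - b s * w, 1:]) \<le> card S - (CARD('p) - 1)"
proof -
  define P where "P = (\<Prod>s\<in>S. [:[:c s, 1:], [:- b s:]:])"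
  note deg = degree_prod_bivariate_linear[OF assms, of c b, folded P_def]
    degree_coeff_prod_bivariate_linear[OF assms, of c b, folded P_def]
  have ev: "(\<Prod>s\<in>S. [:c s - b s * w, 1:]) = (\<Sum>j\<le>card S. coeff P j * [:w ^ j:])" for w
  proof -
    have "(\<Prod>s\<in>S. [:c s - b s * w, 1:]) = poly P [:w:]"
      by (simp add: P_def poly_prod mult.commute)
    also have "\<dots> = (\<Sum>j\<le>card S. coeff P j * [:w:] ^ j)"
      unfolding poly_altdef using deg(1)
      by (intro sum.mono_neutral_left) (auto simp: not_le coeff_eq_0)
    finally show ?thesis by (simp add: poly_const_pow)
  qed
  have "(\<Sum>w\<in>UNIV. \<Prod>s\<in>S. [:c s - b s * w, 1:])
      = (\<Sum>j\<le>card S. \<Sum>w\<in>UNIV. coeff P j * [:w ^ j:])"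
    unfolding ev by (rule sum.swap)
  also have "\<dots> = (\<Sum>j\<le>card S. smult (\<Sum>w\<in>UNIV. w ^ j) (coeff P j))"
    by (simp add: smult_sum)
  also have "degree \<dots> \<le> card S - (CARD('p) - 1)"
  proof (rule degree_sum_le)
    fix j
    show "degree (smult (\<Sum>w\<in>UNIV. w ^ j) (coeff P j)) \<le> card S - (CARD('p) - 1)"
    proof (cases "j < CARD('p) - 1")
      case True
      then show ?thesis by (simp add: sum_power_mod_ring_eq_0)
    next
      case False
      then show ?thesis
        using degree_smult_le[of "\<Sum>w\<in>UNIV. w ^ j" "coeff P j"] deg(2)[of j] by linarith
    qed
  qed simp
  finally show ?thesis .
qed

section \<open>Divisibility and degree tools\<close>

lemma monom_card_minus_X_dvd:
  fixes P :: "'p::prime_card mod_ring poly"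
  assumes "\<And>x. poly P x = 0"
  shows "(monom 1 CARD('p) - [:0, 1:]) dvd P"
proof -
  define X where "X = (monom 1 CARD('p) - [:0, 1:] :: 'p mod_ring poly)"
  have p: "CARD('p) > 1" using prime_card[where 'a = 'p] prime_gt_1_nat by blast
  have degX: "degree X = CARD('p)"
    unfolding X_def using p
    by (subst diff_conv_add_uminus, subst degree_add_eq_left) (auto simp: degree_monom_eq)
  have "poly X x = 0" for x
    using finite_field_power_card_eq_same[of x] by (simp add: X_def poly_monom)
  \<comment> \<open>By Fermat, T^p - T vanishes everywhere, so the remainder inherits all p roots
    although its degree is below p.\<close>
  hence root: "poly (P mod X) x = 0" for x
    using assms[of x] by (simp add: poly_mod)
  have "P mod X = 0"
  proof (rule ccontr)
    assume nz: "P mod X \<noteq> 0"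
    have "CARD('p) \<le> degree (P mod X)"
      using poly_roots_degree[OF nz] root by simp
    thus False using degree_mod_less[of X P] nz degX p by fastforce
  qed
  thus ?thesis unfolding X_def by (simp add: mod_eq_0_iff_dvd)
qed

lemma prod_linear_dvd:
  fixes g :: "'a::field poly"
  assumes "finite A" "\<And>a. a \<in> A \<Longrightarrow> poly g (- a) = 0"
  shows "(\<Prod>a\<in>A. [:a, 1:]) dvd g"
  using assms
proof (induction A arbitrary: g rule: finite_induct)
  case (insert x A)
  then obtain q where q: "g = [:x, 1:] * q"
    using poly_eq_0_iff_dvd[of g "- x"] by auto
  have "(\<Prod>a\<in>A. [:a, 1:]) dvd q"
  proof (rule insert.IH)
    fix a assume a: "a \<in> A"
    with insert.hyps have "x - a \<noteq> 0" by auto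
    with insert.prems[of a] a q show "poly q (- a) = 0" by simp
  qed
  then show ?case using insert.hyps unfolding q by (simp del: mult_pCons_left)
qed simp

text \<open>The equation says that \<open>g\<close> and \<open>F ^ k\<close> have the same logarithmic derivative, so
  every root of \<open>F\<close> has multiplicity \<open>k\<close> modulo \<open>p\<close> in \<open>g\<close>, hence at least \<open>k\<close> when \<open>k < p\<close>.\<close>

lemma prod_linear_power_dvd:
  fixes g :: "'p::prime_card mod_ring poly"
  assumes "k < CARD('p)" "F = (\<Prod>a\<in>A. [:a, 1:])"
    and "smult (of_nat k) (pderiv F) * g = F * pderiv g"
  shows "F ^ k dvd g"
  using assms(1,3)
proof (induction k arbitrary: g)
  case (Suc k)
  have k: "(of_nat (Suc k) :: 'p mod_ring) \<noteq> 0"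
  proof
    assume "(of_nat (Suc k) :: 'p mod_ring) = 0"
    hence "CARD('p) dvd Suc k" by (rule of_nat_0_mod_ring_dvd)
    thus False using Suc.prems(1) dvd_imp_le by fastforce
  qed
  have F0: "F \<noteq> 0" by (simp add: assms(2))
  have "F dvd g"
    unfolding assms(2)
  proof (rule prod_linear_dvd)
    fix a assume a: "a \<in> A"
    have "poly F (- a) = 0" using a by (auto simp: assms(2) poly_prod)
    hence "poly (smult (of_nat (Suc k)) (pderiv F) * g) (- a) = 0"
      unfolding Suc.prems(2) by simp
    \<comment> \<open>The roots of F are simple, so F' is nonzero at -a and the other factor g must
      vanish there.\<close>
    moreover have "poly (pderiv F) (- a) = (\<Prod>b\<in>A - {a}. b - a)"
    proof -
      have "poly (pderiv F) (- a) = (\<Sum>x\<in>A. \<Prod>b\<in>A - {x}. b - a)"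
        by (simp add: assms(2) pderiv_prod pderiv_pCons poly_sum poly_prod)
      also have "\<dots> = (\<Prod>b\<in>A - {a}. b - a) + (\<Sum>x\<in>A - {a}. \<Prod>b\<in>A - {x}. b - a)"
        using a by (subst sum.remove[of _ a]) auto
      also have "(\<Sum>x\<in>A - {a}. \<Prod>b\<in>A - {x}. b - a) = 0"
        using a by (intro sum.neutral ballI prod_zero) auto
      finally show ?thesis by simp
    qed
    ultimately show "poly g (- a) = 0" using k by auto
  qed simp
  then obtain q where q: "g = F * q" by blast
  have "F * (smult (of_nat (Suc k)) (pderiv F) * q) = F * (F * pderiv q + pderiv F * q)"
    using Suc.prems(2) unfolding q by (simp add: pderiv_mult algebra_simps)
  hence "smult (of_nat (Suc k)) (pderiv F) * q = F * pderiv q + pderiv F * q"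
    using F0 mult_left_cancel by blast
  \<comment> \<open>The product rule uses up one copy of F' q, so q satisfies the same equation with
    k in place of k + 1.\<close>
  hence "smult (of_nat k) (pderiv F) * q = F * pderiv q"
    by (simp add: smult_add_left algebra_simps)
  from Suc.IH[OF _ this] Suc.prems(1) show ?case
    unfolding q by (simp add: mult_dvd_mono)
qed simp

lemma degree_wronskian_le:
  fixes g h :: "'a::idom poly"
  assumes "degree g \<le> m" "degree h \<le> m + 1"
  shows "degree (h * pderiv g - pderiv h * g) \<le> 2 * m"
proof (rule degree_diff_le)
  have "degree (pderiv h) \<le> m" using degree_pderiv_le[of h] assms by simp
  thus "degree (pderiv h * g) \<le> 2 * m"
    using degree_mult_le[of "pderiv h" g] assms by simp
  show "degree (h * pderiv g) \<le> 2 * m"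
  \<comment> \<open>For constant g the truncated bound on the degree of g' gains nothing, but then
    g' = 0.\<close>
  proof (cases "degree g = 0")
    case True
    then show ?thesis using TrueI by (auto elim: degree_eq_zeroE simp: pderiv_pCons)
  next
    case False
    then show ?thesis
      using degree_mult_le[of h "pderiv g"] degree_pderiv_le[of g] assms by simp
  qed
qed


section \<open>Redei's method for sets blocking all progressions\<close>

lemma card_blocking_set_lower_bound:
  fixes A :: "'p::prime_card mod_ring set"
  assumes "k < CARD('p)"
    and block: "\<And>w x. w \<noteq> 0 \<Longrightarrow> \<exists>a\<in>A. \<exists>i\<in>{1..k}. x + a = of_nat i * w"
  shows "2 * CARD('p) \<le> card A * (k + 1)"
proof -
  define p where "p = CARD('p)"
  define S where "S = A \<times> {1..k}"
  define N where "N = card A * k"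
  define P where "P w = (\<Prod>s\<in>S. [:fst s - of_nat (snd s) * w, 1:])" for w :: "'p mod_ring"
  define F where "F = (\<Prod>a\<in>A. [:a, 1:])"
  define X where "X = (monom 1 p - [:0, 1:] :: 'p mod_ring poly)"
  define Q where "Q = (\<Sum>w\<in>UNIV. P w)"
  have p: "p > 1" using prime_card[where 'a = 'p] prime_gt_1_nat by (auto simp: p_def)
  have finS: "finite S" and cardS: "card S = N" by (auto simp: S_def N_def)
  have degP: "degree (P w) = N" for w
    unfolding P_def using cardS by (subst degree_prod_sum_eq) auto
  have P0: "P w \<noteq> 0" for w
    using finS by (simp add: P_def)
  have van: "poly (P w) x = 0" if w: "w \<noteq> 0" for w x
  proof -
    from block[OF w, of x] obtain a i where "a \<in> A" "i \<in> {1..k}" "x + a = of_nat i * w"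
      by blast
    thus ?thesis
      unfolding P_def poly_prod using finS
      by (intro prod_zero) (auto simp: S_def algebra_simps intro!: bexI[of _ a] bexI[of _ i])
  qed
  \<comment> \<open>P_1 is nonzero of degree N with p roots. This also makes N - p an honest
    difference below.\<close>
  have pN: "p \<le> N"
    using poly_roots_degree[OF P0[of 1]] van[of 1] degP[of 1] by (simp add: p_def)
  have k: "k > 0" using pN p by (cases k) (auto simp: N_def)
  have f: "P 0 = F ^ k"
  proof -
    have "P 0 = (\<Prod>a\<in>A. \<Prod>i\<in>{1..k}. [:a, 1:])"
      by (simp add: P_def S_def prod.cartesian_product case_prod_unfold del: prod_constant)
    thus ?thesis by (simp add: F_def prod_power_distrib)
  qed
  have "P 0 - Q = - (\<Sum>w\<in>UNIV - {0}. P w)"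
    unfolding Q_def by (subst sum.remove[of _ 0]) auto
  moreover have "X dvd (\<Sum>w\<in>UNIV - {0}. P w)"
    unfolding X_def p_def by (intro dvd_sum monom_card_minus_X_dvd van) auto
  ultimately obtain g where g: "P 0 - Q = X * g" by (metis dvd_minus_iff dvdE)
  have degQ: "degree Q \<le> N - p + 1"
    using degree_sum_prod_linear_mod_ring[OF finS, of fst "\<lambda>s. of_nat (snd s)"] cardS pN p
    by (simp add: Q_def P_def p_def)
  have degX: "degree X = p"
    unfolding X_def using p
    by (subst diff_conv_add_uminus, subst degree_add_eq_left) (auto simp: degree_monom_eq)
  \<comment> \<open>As p \<ge> 2, deg Q \<le> N - p + 1 < N, so Q cannot cancel the leading
    term.\<close>
  have "degree (P 0 - Q) = N"
    using degP[of 0] degQ p pN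
    by (subst diff_conv_add_uminus, subst degree_add_eq_left) auto
  hence "degree (X * g) = N" and g0: "g \<noteq> 0"
    using g p pN by auto
  hence degg: "degree g = N - p"
    using degX p by (subst (asm) degree_mult_eq) auto
  define h where "h = Q - [:0, 1:] * g"
  have "degree ([:0, 1:] * g) \<le> N - p + 1"
    using degree_mult_le[of "[:0, 1:]" g] degg by (simp del: mult_pCons_left)
  hence degh: "degree h \<le> N - p + 1"
    unfolding h_def using degQ by (intro degree_diff_le) auto
  have fgh: "P 0 = monom 1 p * g + h"
    using g by (simp add: h_def X_def algebra_simps)
  have "pderiv (monom 1 p) = (0 :: 'p mod_ring poly)"
    by (simp add: pderiv_monom p_def)
  hence df: "pderiv (P 0) = monom 1 p * pderiv g + pderiv h"
    by (simp add: fgh pderiv_add pderiv_mult)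
  define W where "W = h * pderiv g - pderiv h * g"
  \<comment> \<open>T^p behaves as a constant under derivation, so adding T^p g to h leaves the
    Wronskian with g unchanged.\<close>
  have W: "W = P 0 * pderiv g - pderiv (P 0) * g"
    unfolding W_def df by (simp add: fgh algebra_simps)
  have dF: "pderiv (P 0) = F ^ (k - 1) * smult (of_nat k) (pderiv F)"
    using k by (simp add: f pderiv_power)
  have f': "P 0 = F ^ (k - 1) * F"
    using k by (simp add: f power_eq_if)
  have W': "W = F ^ (k - 1) * (F * pderiv g - smult (of_nat k) (pderiv F) * g)"
    unfolding W dF by (simp add: f' algebra_simps)
  have F0: "F \<noteq> 0" by (simp add: F_def)
  have "W \<noteq> 0"
  proof
    assume "W = 0"
    hence "smult (of_nat k) (pderiv F) * g = F * pderiv g"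
      using F0 by (simp add: W')
    \<comment> \<open>A zero Wronskian would make F^k, of degree N, divide the nonzero g of degree N
      - p.\<close>
    hence "P 0 dvd g"
      unfolding f by (intro prod_linear_power_dvd[OF assms(1) F_def])
    hence "N \<le> N - p" using dvd_imp_degree_le[of "P 0" g] g0 degP degg by simp
    thus False using p pN by simp
  qed
  moreover have "F ^ (k - 1) dvd W" unfolding W' by simp
  ultimately have "degree (F ^ (k - 1)) \<le> degree W" by (rule dvd_imp_degree_le[rotated])
  also have "degree W \<le> 2 * (N - p)"
    unfolding W_def using degg degh by (intro degree_wronskian_le) auto
  also have "degree (F ^ (k - 1)) = (k - 1) * card A"
    using F0 by (simp add: degree_power_eq F_def degree_prod_sum_eq)
  finally have "(k - 1) * card A \<le> 2 * (N - p)" .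
  moreover have "N = (k - 1) * card A + card A" using k by (cases k) (auto simp: N_def)
  ultimately have "2 * p \<le> N + card A" using pN by simp
  thus ?thesis by (simp add: p_def N_def)
qed

section \<open>From gaps of dilates to blocked progressions\<close>

lemma card_mult_gap_lower_bound:
  fixes A :: "'p::prime_card mod_ring set"
  assumes "card A > 1" and "\<And>d. d \<noteq> 0 \<Longrightarrow> largest_gap (dilate d A) \<le> M"
  shows "2 * CARD('p) \<le> card A * (M + 2)"
proof (cases "M + 1 < CARD('p)")
  case True
  have "\<exists>a\<in>A. \<exists>i\<in>{1..M + 1}. x + a = of_nat i * w" if w: "w \<noteq> 0" for w x
  proof -
    have "A \<noteq> {}" using assms(1) by (intro notI) simp
    hence "\<not> gap_at_least (dilate (1 / w) A) (M + 1)"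
      using largest_gap_ge[of "dilate (1 / w) A" "M + 1"] assms(2)[of "1 / w"] w
      by (auto simp: dilate_def)
    \<comment> \<open>An interval shifted by -x/w meets the dilate by 1/w; multiplying by w gives a
      progression of difference w meeting x + A.\<close>
    then obtain i a where "i \<in> {1..M + 1}" "a \<in> A" "of_nat i + - (x / w) = 1 / w * a"
      unfolding gap_at_least_def dilate_def by blast
    moreover from this(3) have "x + a = of_nat i * w"
      using w by (simp add: field_simps)
    ultimately show ?thesis by blast
  qed
  from card_blocking_set_lower_bound[OF True this] show ?thesis by simp
next
  case False
  \<comment> \<open>Here M + 2 \<ge> p and |A| \<ge> 2.\<close>
  then show ?thesis using assms(1) by (intro mult_mono) auto
qed

theorem theorem1:
  fixes A :: "'p::prime_card mod_ring set"
  assumes "card A > 1"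
  shows "L A \<ge> 2 * (1 - real (card A) / real CARD('p)) \<and>
         (SUP d \<in> UNIV - {0}. real (largest_gap (dilate d A))) \<ge>
           2 * (real CARD('p) / real (card A) - 1)"
proof -
  \<comment> \<open>There are finitely many dilations, so a natural number maximum can serve as the
    bound M.\<close>
  define G where "G = (\<lambda>d. largest_gap (dilate d A)) ` (UNIV - {0})"
  define s where "s = (SUP d \<in> UNIV - {0}. real (largest_gap (dilate d A)))"
  have "(1 :: 'p mod_ring) \<in> UNIV - {0}" by simp
  hence G: "finite G" "G \<noteq> {}" unfolding G_def by (simp, blast)
  have "2 * CARD('p) \<le> card A * (Max G + 2)"
    using G by (intro card_mult_gap_lower_bound assms Max_ge) (auto simp: G_def)
  hence "real (2 * CARD('p)) \<le> real (card A * (Max G + 2))"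
    by (simp only: of_nat_le_iff)
  hence M: "2 * real CARD('p) \<le> real (card A) * (real (Max G) + 2)"
    by (simp add: algebra_simps)
  from Max_in[OF G] obtain d where d: "d \<in> UNIV - {0}" "Max G = largest_gap (dilate d A)"
    by (auto simp: G_def)
  have "real (Max G) \<le> s"
    unfolding s_def d(2) using d(1) by (intro cSUP_upper) auto
  with M have "2 * real CARD('p) \<le> real (card A) * (s + 2)"
    by (elim order.trans) (intro mult_left_mono, auto)
  hence *: "2 * (real CARD('p) / real (card A) - 1) \<le> s"
    using assms by (simp add: field_simps)
  \<comment> \<open>The bound on L is the bound on the supremum scaled by |A| / p.\<close>
  have "2 * (1 - real (card A) / real CARD('p))
      = real (card A) / real CARD('p) * (2 * (real CARD('p) / real (card A) - 1))"
    using assms by (cases "A = {}") (simp_all add: field_simps)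
  also have "\<dots> \<le> real (card A) / real CARD('p) * s"
    using * by (intro mult_left_mono) auto
  finally show ?thesis using * by (simp add: L_def s_def)
qed

end
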